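(* If $X$ is either $C[0,1]$ or $\ell_\infty$, then $X$ has the 1-ASD2P$_{<|X^*|}$.
   Context: Spaces are real. $C[0,1]$ is the space of continuous functions on $[0,1]$ with the supremum norm, $\ell_\infty$ the space of bounded real sequences with the supremum norm; $|X^*|$ is the cardinality of the dual $X^*$, and $S_X$ is the unit sphere of $X$. For $B\subset X$ and $A\subset X^*$, $B$ norms $A$ if for every $\lambda\in(0,1)$ and every $x^*\in A$ there is $x\in B\setminus\{0\}$ with $x^*(x)\ge\lambda\|x^*\|\|x\|$. For an infinite cardinal $\kappa$, $X$ has the 1-ASD2P$_{<\kappa}$ if for every set $A\subset S_{X^*}$ of cardinality strictly smaller than $\kappa$ there are $B\subset S_X$ and $x^*\in S_{X^*}$ such that $B$ norms $A$ and $x^*(x)=1$ for every $x\in B$. *)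

theory Defs
  imports "HOL-Analysis.Analysis"
begin

unbundle cardinal_syntax

typedef unit_interval = "{0..1::real}"
  by auto

setup_lifting type_definition_unit_interval

instantiation unit_interval :: metric_space
begin

lift_definition dist_unit_interval :: "unit_interval \<Rightarrow> unit_interval \<Rightarrow> real" is dist .

definition uniformity_unit_interval :: "(unit_interval \<times> unit_interval) filter"
  where "uniformity_unit_interval = (INF e\<in>{0<..}. principal {(x, y). dist x y < e})"

definition open_unit_interval :: "unit_interval set \<Rightarrow> bool"
  where "open_unit_interval U \<longleftrightarrow> (\<forall>x\<in>U. \<forall>\<^sub>F (x', y) in uniformity. x' = x \<longrightarrow> y \<in> U)"

instance
proof
  fix x y z :: unit_interval
  show "dist x y = 0 \<longleftrightarrow> x = y"
    by transfer simp
  show "dist x y \<le> dist x z + dist y z"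
    by transfer (rule dist_triangle2)
qed (rule uniformity_unit_interval_def open_unit_interval_def)+

end

type_synonym C01 = "unit_interval \<Rightarrow>\<^sub>C real"

text \<open>Every function on \<^typ>\<open>nat\<close> is continuous, so the bounded continuous functions on it
  are exactly the bounded sequences.\<close>

type_synonym l_infty = "nat \<Rightarrow>\<^sub>C real"

lemma continuous_on_Rep_unit_interval: "continuous_on S Rep_unit_interval"
  unfolding continuous_on_iff by (auto simp: dist_unit_interval.rep_eq)

lemma continuous_on_Abs_unit_interval: "continuous_on {0..1} Abs_unit_interval"
  unfolding continuous_on_iff
  by (auto simp: dist_unit_interval.rep_eq Abs_unit_interval_inverse)

lemma compact_UNIV_unit_interval: "compact (UNIV :: unit_interval set)"
proof -
  have "UNIV = Abs_unit_interval ` {0..1}"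
    by (metis (full_types) Rep_unit_interval Rep_unit_interval_inverse image_iff UNIV_eq_I)
  then show ?thesis
    by (metis compact_Icc compact_continuous_image continuous_on_Abs_unit_interval)
qed

text \<open>By compactness, boundedness is no restriction in \<^typ>\<open>C01\<close>: its elements are precisely the
  continuous functions on the interval.\<close>

lemma continuous_on_unit_interval_iff_C01:
  "continuous_on {0..1} f \<longleftrightarrow> (\<exists>g :: C01. \<forall>t\<in>{0..1}. f t = apply_bcontfun g (Abs_unit_interval t))"
proof
  assume f: "continuous_on {0..1} f"
  have c: "continuous_on UNIV (f \<circ> Rep_unit_interval)"
    by (rule continuous_on_compose[OF continuous_on_Rep_unit_interval])
      (rule continuous_on_subset[OF f], use Rep_unit_interval in auto)
  then have "bounded (range (f \<circ> Rep_unit_interval))"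
    by (intro compact_imp_bounded compact_continuous_image compact_UNIV_unit_interval)
  with c have "f \<circ> Rep_unit_interval \<in> bcontfun"
    by (simp add: bcontfun_def)
  then obtain g :: C01 where "f \<circ> Rep_unit_interval = apply_bcontfun g"
    by (rule bcontfunE)
  then show "\<exists>g :: C01. \<forall>t\<in>{0..1}. f t = apply_bcontfun g (Abs_unit_interval t)"
    by (metis Abs_unit_interval_inverse comp_apply)
next
  assume "\<exists>g :: C01. \<forall>t\<in>{0..1}. f t = apply_bcontfun g (Abs_unit_interval t)"
  then obtain g :: C01 where g: "\<forall>t\<in>{0..1}. f t = apply_bcontfun g (Abs_unit_interval t)"
    by blast
  have "continuous_on {0..1} (apply_bcontfun g \<circ> Abs_unit_interval)"
    by (intro continuous_on_compose continuous_on_Abs_unit_interval continuous_on_apply_bcontfun)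
  then show "continuous_on {0..1} f"
    by (rule continuous_on_eq) (use g in simp)
qed

definition norms :: "'a::real_normed_vector set \<Rightarrow> ('a \<Rightarrow>\<^sub>L real) set \<Rightarrow> bool" where
  "norms B A \<longleftrightarrow>
     (\<forall>r\<in>{0<..<1}. \<forall>f\<in>A. \<exists>x\<in>B - {0}. blinfun_apply f x \<ge> r * norm f * norm x)"

text \<open>Cardinals are represented by cardinal order relations, as in the library. The property is
  only considered for infinite cardinals; this requirement is part of the predicate.\<close>

definition one_ASD2P_below :: "'a::real_normed_vector itself \<Rightarrow> 'k rel \<Rightarrow> bool" where
  "one_ASD2P_below X \<kappa> \<longleftrightarrow> Cinfinite \<kappa> \<and>
     (\<forall>A :: ('a \<Rightarrow>\<^sub>L real) set. A \<subseteq> sphere 0 1 \<and> |A| <o \<kappa> \<longrightarrow>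
       (\<exists>B. \<exists>f :: 'a \<Rightarrow>\<^sub>L real. B \<subseteq> sphere 0 1 \<and> f \<in> sphere 0 1 \<and>
          norms B A \<and> (\<forall>x\<in>B. blinfun_apply f x = 1)))"

end

theory Submission
  imports Defs
begin

text \<open>
  Both spaces consist of the bounded continuous functions on a space \<open>T\<close> (the interval, or the
  discrete natural numbers) and can be viewed as \<open>C(K)\<close> for a compact \<open>K\<close>: the interval itself, or
  the Stone-Cech compactification of the naturals. A point of \<open>K\<close> is represented below by the
  filter on \<open>T\<close> that converges to it: a neighbourhood filter, or an ultrafilter.

  A functional \<open>f\<close> corresponds to a finite signed measure on \<open>K\<close>, so only countably many points of
  \<open>K\<close> are atoms of \<open>f\<close>. The set of all atoms of fewer than \<open>|K|\<close> functionals therefore has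
  cardinality smaller than \<open>|K|\<close>, and there is a point \<open>p\<close> that is an atom of none of them. The
  witnesses are the evaluation at \<open>p\<close> and the set \<open>B\<close> of all norm-one functions whose value at \<open>p\<close>
  is one. Indeed, if \<open>p\<close> is not an atom of \<open>f\<close>, then an almost norming function \<open>x\<close> can be changed
  in a small neighbourhood of \<open>p\<close> so as to take the value one there, and since \<open>f\<close> has little mass
  in that neighbourhood, the changed function is still almost norming
  (\<open>norming_function_through_point\<close>). Measures are avoided: an atom of \<open>f\<close> is a point every
  neighbourhood of which supports functions of the unit ball with \<open>f\<close>-values bounded away from zero.
  Disjointly supported functions of the unit ball add up to a function of the unit ball, which
  limits the number of atoms of a given size (\<open>card_atoms_bound\<close>).

  It remains to see that \<open>K\<close> has at least as many points as there are functionals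
  (\<open>one_ASD2P_of_points\<close> reduces the theorem to this). On the interval, a functional is
  determined by its values on the monomials, by Weierstrass approximation, so there are at most
  continuum many functionals. For the bounded sequences there are at most \<open>2\<close> to the continuum
  functionals, and by a theorem of Pospisil there are that many ultrafilters on the naturals
  (\<open>many_ultrafilters\<close>).
\<close>

section \<open>Points as filters\<close>

text \<open>Convergence of all functions along \<open>F\<close> makes evaluation at the point possible. The last
  clause is the Urysohn property that continuous functions peak at the point within any
  neighbourhood of it.\<close>

definition point_filter :: "'a::topological_space filter \<Rightarrow> bool" where
  "point_filter F \<longleftrightarrow> F \<noteq> bot \<and> (\<forall>x :: 'a \<Rightarrow>\<^sub>C real. \<exists>l. (x \<longlongrightarrow> l) F) \<and>
     (\<forall>P. eventually P F \<longrightarrow>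
       (\<exists>g :: 'a \<Rightarrow>\<^sub>C real. (\<forall>t. 0 \<le> g t \<and> g t \<le> 1) \<and> (\<forall>t. \<not> P t \<longrightarrow> g t = 0) \<and> (g \<longlongrightarrow> 1) F))"

definition point_evaluation :: "'a::topological_space filter \<Rightarrow> ('a \<Rightarrow>\<^sub>C real) \<Rightarrow>\<^sub>L real" where
  "point_evaluation F = Blinfun (\<lambda>x. Lim F (apply_bcontfun x))"

lemma point_evaluation_tendsto:
  assumes "point_filter F"
  shows "(apply_bcontfun x \<longlongrightarrow> blinfun_apply (point_evaluation F) x) F"
proof -
  have nb: "F \<noteq> bot" and "\<exists>l. (apply_bcontfun y \<longlongrightarrow> l) F" for y :: "'a \<Rightarrow>\<^sub>C real"
    using assms by (auto simp: point_filter_def)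
  then have lim: "(apply_bcontfun y \<longlongrightarrow> Lim F (apply_bcontfun y)) F" for y :: "'a \<Rightarrow>\<^sub>C real"
    by (metis tendsto_Lim)
  have "bounded_linear (\<lambda>y :: 'a \<Rightarrow>\<^sub>C real. Lim F (apply_bcontfun y))"
  proof (rule bounded_linear_intro[where K = 1])
    fix y z :: "'a \<Rightarrow>\<^sub>C real" and r :: real
    show "Lim F (apply_bcontfun (y + z)) = Lim F (apply_bcontfun y) + Lim F (apply_bcontfun z)"
      using tendsto_add[OF lim[of y] lim[of z]] by (intro tendsto_Lim nb) simp
    show "Lim F (apply_bcontfun (r *\<^sub>R y)) = r *\<^sub>R Lim F (apply_bcontfun y)"
      using tendsto_scaleR[OF tendsto_const lim[of y]] by (intro tendsto_Lim nb) simp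
    show "norm (Lim F (apply_bcontfun y)) \<le> norm y * 1"
      using tendsto_norm[OF lim[of y]] by (intro tendsto_upperbound[OF _ _ nb])
        (auto simp: norm_bounded simp del: real_norm_def)
  qed
  then show ?thesis
    using lim by (simp add: point_evaluation_def bounded_linear_Blinfun_apply)
qed

lemma point_evaluation_eqI:
  assumes "point_filter F" "(apply_bcontfun x \<longlongrightarrow> l) F"
  shows "blinfun_apply (point_evaluation F) x = l"
  using tendsto_unique[OF _ point_evaluation_tendsto[OF assms(1)] assms(2)] assms(1)
  by (simp add: point_filter_def)

lemma norm_point_evaluation:
  assumes F: "point_filter F"
  shows "norm (point_evaluation F) = 1"
proof (rule antisym)
  have nb: "F \<noteq> bot"
    using F by (simp add: point_filter_def)
  show "norm (point_evaluation F) \<le> 1"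
  proof (rule norm_blinfun_bound)
    fix x
    show "norm (blinfun_apply (point_evaluation F) x) \<le> 1 * norm x"
      using tendsto_norm[OF point_evaluation_tendsto[OF F, of x]]
      by (intro tendsto_upperbound[OF _ _ nb]) (auto simp: norm_bounded simp del: real_norm_def)
  qed simp
  have "blinfun_apply (point_evaluation F) (const_bcontfun 1) = 1"
    by (rule point_evaluation_eqI[OF F]) simp
  moreover have "norm (const_bcontfun 1 :: 'a \<Rightarrow>\<^sub>C real) \<le> 1"
    by (rule norm_bound) simp
  ultimately show "1 \<le> norm (point_evaluation F)"
    using norm_blinfun[of "point_evaluation F" "const_bcontfun 1"]
      mult_left_mono[of "norm (const_bcontfun 1 :: 'a \<Rightarrow>\<^sub>C real)" 1 "norm (point_evaluation F)"]
    by simp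
qed

section \<open>Atoms of a functional\<close>

text \<open>Up to the boundary case of equality, this says that the measure representing \<open>f\<close> gives the
  point a mass of absolute value larger than \<open>e\<close>. An absolute value around \<open>f x\<close> would change
  nothing, because the unit ball is symmetric.\<close>

definition atom_above :: "real \<Rightarrow> (('a::topological_space \<Rightarrow>\<^sub>C real) \<Rightarrow>\<^sub>L real) \<Rightarrow> 'a filter \<Rightarrow> bool" where
  "atom_above e f F \<longleftrightarrow> (\<forall>P. eventually P F \<longrightarrow>
     (\<exists>x. norm x \<le> 1 \<and> (\<forall>t. \<not> P t \<longrightarrow> apply_bcontfun x t = 0) \<and> e < blinfun_apply f x))"

lemma pairwise_disjoint_neighbourhoods:
  assumes "finite T" and disj: "\<And>F G. F \<in> T \<Longrightarrow> G \<in> T \<Longrightarrow> F \<noteq> G \<Longrightarrow> inf F G = (bot :: 'a filter)"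
  obtains P where "\<And>F. F \<in> T \<Longrightarrow> eventually (P F) F"
    and "\<And>F G t. F \<in> T \<Longrightarrow> G \<in> T \<Longrightarrow> F \<noteq> G \<Longrightarrow> P F t \<Longrightarrow> \<not> P G t"
proof -
  have "\<exists>P Q. F \<in> T \<and> G \<in> T \<and> F \<noteq> G \<longrightarrow>
      eventually P F \<and> eventually Q G \<and> (\<forall>t. P t \<longrightarrow> \<not> Q t)" for F G
  proof (cases "F \<in> T \<and> G \<in> T \<and> F \<noteq> G")
    case True
    then have "eventually (\<lambda>_. False) (inf F G)"
      using disj by simp
    then show ?thesis
      unfolding eventually_inf by blast
  qed auto
  then obtain P Q where "\<forall>F G. F \<in> T \<and> G \<in> T \<and> F \<noteq> G \<longrightarrow>
      eventually (P F G) F \<and> eventually (Q F G) G \<and> (\<forall>t. P F G t \<longrightarrow> \<not> Q F G t)"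
    by metis
  then have PQ: "eventually (P F G) F" "eventually (Q F G) G" "P F G t \<Longrightarrow> \<not> Q F G t"
    if "F \<in> T" "G \<in> T" "F \<noteq> G" for F G t
    using that by blast+
  show ?thesis
  proof
    fix F assume "F \<in> T"
    then show "eventually (\<lambda>t. \<forall>G\<in>T - {F}. P F G t \<and> Q G F t) F"
      using \<open>finite T\<close> by (auto simp: eventually_ball_finite_distrib eventually_conj_iff intro: PQ)
  next
    fix F G t
    assume "F \<in> T" "G \<in> T" "F \<noteq> G" "\<forall>G\<in>T - {F}. P F G t \<and> Q G F t"
    then show "\<not> (\<forall>F\<in>T - {G}. P G F t \<and> Q F G t)"
      using PQ(3)[of F G t] by blast
  qed
qed

lemma apply_bcontfun_sum:
  "apply_bcontfun (\<Sum>i\<in>I. x i) t = (\<Sum>i\<in>I. apply_bcontfun (x i) t)"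
  for x :: "'i \<Rightarrow> 'a::topological_space \<Rightarrow>\<^sub>C 'b::real_normed_vector"
  by (induction I rule: infinite_finite_induct) auto

text \<open>Test the functional on the sum of functions that witness the atoms and are supported in
  disjoint neighbourhoods: at each \<open>t\<close> only one summand is nonzero, so the sum stays in the unit
  ball.\<close>

lemma card_atoms_bound:
  fixes e :: real
  assumes "finite T" and disj: "\<And>F G. F \<in> T \<Longrightarrow> G \<in> T \<Longrightarrow> F \<noteq> G \<Longrightarrow> inf F G = bot"
    and atoms: "\<And>F. F \<in> T \<Longrightarrow> atom_above e f F"
  shows "real (card T) * e \<le> norm f"
proof -
  obtain P where P: "\<And>F. F \<in> T \<Longrightarrow> eventually (P F) F"
    and dP: "\<And>F G t. F \<in> T \<Longrightarrow> G \<in> T \<Longrightarrow> F \<noteq> G \<Longrightarrow> P F t \<Longrightarrow> \<not> P G t"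
    using pairwise_disjoint_neighbourhoods[OF assms(1) disj] by metis
  have "\<forall>F\<in>T. \<exists>x. norm x \<le> 1 \<and> (\<forall>t. \<not> P F t \<longrightarrow> apply_bcontfun x t = 0) \<and> e < blinfun_apply f x"
    using atoms P unfolding atom_above_def by blast
  then obtain x where x: "\<And>F. F \<in> T \<Longrightarrow> norm (x F) \<le> 1"
    "\<And>F t. F \<in> T \<Longrightarrow> \<not> P F t \<Longrightarrow> apply_bcontfun (x F) t = 0"
    "\<And>F. F \<in> T \<Longrightarrow> e < blinfun_apply f (x F)"
    by metis
  have "norm (\<Sum>F\<in>T. x F) \<le> 1"
  proof (rule norm_bound)
    fix t
    show "norm (apply_bcontfun (\<Sum>F\<in>T. x F) t) \<le> 1"
    proof (cases "\<exists>G\<in>T. P G t")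
      case True
      then obtain G where G: "G \<in> T" "P G t" by blast
      then have "apply_bcontfun (x F) t = 0" if "F \<in> T - {G}" for F
        using that dP[of G F t] x(2)[of F t] by blast
      then have "(\<Sum>F\<in>T. apply_bcontfun (x F) t) = (\<Sum>F\<in>{G}. apply_bcontfun (x F) t)"
        using G \<open>finite T\<close> by (intro sum.mono_neutral_right) auto
      then show ?thesis
        using norm_bounded[of "x G" t] x(1)[OF G(1)] by (simp add: apply_bcontfun_sum)
    next
      case False
      then show ?thesis
        using x(2) by (simp add: apply_bcontfun_sum)
    qed
  qed
  then have "norm f * norm (\<Sum>F\<in>T. x F) \<le> norm f"
    by (simp add: mult_left_le)
  moreover have "real (card T) * e \<le> (\<Sum>F\<in>T. blinfun_apply f (x F))"
    using x(3) sum_mono[of T "\<lambda>_. e" "\<lambda>F. blinfun_apply f (x F)"] by (simp add: less_imp_le)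
  ultimately show ?thesis
    using norm_blinfun[of f "\<Sum>F\<in>T. x F"] by (simp add: blinfun.sum_right)
qed

lemma countable_atoms:
  assumes disj: "\<And>F G. F \<in> \<F> \<Longrightarrow> G \<in> \<F> \<Longrightarrow> F \<noteq> G \<Longrightarrow> inf F G = bot"
  shows "countable {F \<in> \<F>. \<exists>e>0. atom_above e f F}"
proof -
  have fin: "finite {F \<in> \<F>. atom_above e f F}" if "e > 0" for e
  proof -
    have "card T \<le> nat \<lfloor>norm f / e\<rfloor>" if "T \<subseteq> {F \<in> \<F>. atom_above e f F}" "finite T" for T
    proof -
      have "real (card T) * e \<le> norm f"
      proof (rule card_atoms_bound[OF that(2)])
        show "inf F G = bot" if "F \<in> T" "G \<in> T" "F \<noteq> G" for F G
          using that \<open>T \<subseteq> _\<close> by (intro disj) auto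
        show "atom_above e f F" if "F \<in> T" for F
          using that \<open>T \<subseteq> _\<close> by blast
      qed
      then have "real (card T) \<le> norm f / e"
        using \<open>e > 0\<close> by (simp add: pos_le_divide_eq)
      then show ?thesis
        by linarith
    qed
    then show ?thesis
      using finite_if_finite_subsets_card_bdd by blast
  qed
  have "{F \<in> \<F>. \<exists>e>0. atom_above e f F}
      \<subseteq> (\<Union>n. {F \<in> \<F>. atom_above (inverse (real (Suc n))) f F})"
  proof
    fix F assume "F \<in> {F \<in> \<F>. \<exists>e>0. atom_above e f F}"
    then obtain e where "F \<in> \<F>" "e > 0" and e: "atom_above e f F" by blast
    then obtain n where "inverse (real (Suc n)) < e"
      using reals_Archimedean by blast
    with e have "atom_above (inverse (real (Suc n))) f F"
      unfolding atom_above_def by (meson less_trans)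
    with \<open>F \<in> \<F>\<close> show "F \<in> (\<Union>n. {F \<in> \<F>. atom_above (inverse (real (Suc n))) f F})"
      by blast
  qed
  moreover have "countable (\<Union>n. {F \<in> \<F>. atom_above (inverse (real (Suc n))) f F})"
    by (intro countable_UN countableI_type countable_finite fin) simp
  ultimately show ?thesis
    by (rule countable_subset)
qed

lemma blinfun_almost_norming:
  fixes f :: "'a::real_normed_vector \<Rightarrow>\<^sub>L real"
  assumes "0 \<le> r" "r < norm f"
  shows "\<exists>x. norm x \<le> 1 \<and> r < blinfun_apply f x"
proof (rule ccontr)
  assume "\<not> (\<exists>x. norm x \<le> 1 \<and> r < blinfun_apply f x)"
  then have le: "blinfun_apply f x \<le> r" if "norm x \<le> 1" for x
    using that by (meson not_le)
  have "norm (blinfun_apply f x) \<le> r * norm x" for x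
  proof (cases "x = 0")
    case False
    have "blinfun_apply f (x /\<^sub>R norm x) \<le> r" "blinfun_apply f (- (x /\<^sub>R norm x)) \<le> r"
      using False by (intro le; simp)+
    then have "\<bar>blinfun_apply f x\<bar> / norm x \<le> r"
      by (auto simp: blinfun.minus_right blinfun.scaleR_right divide_inverse_commute abs_if)
    then show ?thesis
      using False by (simp add: pos_divide_le_eq)
  qed simp
  then have "norm f \<le> r"
    using assms(1) by (intro norm_blinfun_bound)
  with assms(2) show False by simp
qed

text \<open>An almost norming function \<open>x\<close> is replaced by the pointwise convex combination
  \<open>x (1 - g) + g\<close>, where \<open>g\<close> peaks at the point in a neighbourhood supporting little of \<open>f\<close>. Then
  \<open>f\<close> almost does not see the functions \<open>x g\<close> and \<open>g\<close>, by which the two differ.\<close>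

lemma norming_function_through_point:
  fixes f :: "('a::topological_space \<Rightarrow>\<^sub>C real) \<Rightarrow>\<^sub>L real"
  assumes F: "point_filter F" and no_atom: "\<not> (\<exists>e>0. atom_above e f F)"
    and r: "0 \<le> r" "r < norm f"
  obtains y where "norm y = 1" "blinfun_apply (point_evaluation F) y = 1" "r \<le> blinfun_apply f y"
proof -
  \<comment> \<open>Two thirds of the gap pay for the two corrections \<open>x g\<close> and \<open>g\<close>; the last third leaves room
    for the almost norming \<open>x\<close>.\<close>
  define e where "e = (norm f - r) / 3"
  have "e > 0"
    using r by (simp add: e_def)
  obtain x where x: "norm x \<le> 1" "r + 2 * e < blinfun_apply f x"
    using blinfun_almost_norming[of "r + 2 * e" f] r by (auto simp: e_def field_simps)
  obtain P where P: "eventually P F"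
    and small: "\<And>z. norm z \<le> 1 \<Longrightarrow> (\<And>t. \<not> P t \<Longrightarrow> apply_bcontfun z t = 0) \<Longrightarrow> blinfun_apply f z \<le> e"
    using no_atom \<open>e > 0\<close> unfolding atom_above_def by (metis not_less)
  obtain g :: "'a \<Rightarrow>\<^sub>C real" where g: "\<And>t. 0 \<le> g t" "\<And>t. g t \<le> 1" "\<And>t. \<not> P t \<Longrightarrow> g t = 0" "(g \<longlongrightarrow> 1) F"
    using F P unfolding point_filter_def by metis
  have xt: "\<bar>apply_bcontfun x t\<bar> \<le> 1" for t
    using norm_bounded[of x t] x(1) by simp
  have gx_le: "\<bar>apply_bcontfun x t * g t\<bar> \<le> g t" for t
    using mult_right_mono[OF xt[of t] g(1)[of t]] g(1)[of t] by (simp add: abs_mult)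
  have "(\<lambda>t. apply_bcontfun x t * g t) \<in> bcontfun"
  proof (rule bcontfun_normI)
    show "continuous_on UNIV (\<lambda>t. apply_bcontfun x t * g t)"
      by (intro continuous_intros) auto
    show "norm (apply_bcontfun x t * g t) \<le> 1" for t
      using gx_le[of t] g(2)[of t] by simp
  qed
  then obtain xg where xg: "\<And>t. apply_bcontfun xg t = apply_bcontfun x t * g t"
    by (metis bcontfunE)
  have ng: "norm g \<le> 1" and nxg: "norm xg \<le> 1"
    using g gx_le by (auto intro!: norm_bound order_trans[OF gx_le] simp: xg)
  have f_xg: "blinfun_apply f xg \<le> e" and f_g: "blinfun_apply f (- g) \<le> e"
    using ng nxg by (auto intro!: small simp: xg g)
  define y where "y = x - xg + g"
  have y1: "blinfun_apply (point_evaluation F) y = 1"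
  proof (rule point_evaluation_eqI[OF F])
    have "((\<lambda>t. apply_bcontfun x t - apply_bcontfun x t * g t + g t) \<longlongrightarrow>
        blinfun_apply (point_evaluation F) x - blinfun_apply (point_evaluation F) x * 1 + 1) F"
      by (intro tendsto_intros g(4) point_evaluation_tendsto[OF F])
    then show "(apply_bcontfun y \<longlongrightarrow> 1) F"
      by (simp add: y_def xg)
  qed
  have "norm y \<le> 1"
  proof (rule norm_bound)
    fix t
    have "\<bar>apply_bcontfun x t * (1 - g t)\<bar> \<le> 1 - g t"
      using mult_right_mono[OF xt[of t], of "1 - g t"] g(2)[of t] by (simp add: abs_mult)
    then show "norm (apply_bcontfun y t) \<le> 1"
      using g(1)[of t] by (simp add: y_def xg algebra_simps)
  qed
  moreover have "1 \<le> norm y"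
    using norm_blinfun[of "point_evaluation F" y] y1 norm_point_evaluation[OF F] by simp
  moreover have "r \<le> blinfun_apply f y"
    using x(2) f_xg f_g by (simp add: y_def blinfun.add_right blinfun.diff_right blinfun.minus_right)
  ultimately show ?thesis
    using that y1 by force
qed

section \<open>Enough points give the property\<close>

text \<open>A union of \<open>|A|\<close> countable sets of atoms has at most the cardinality of the disjoint sum of \<open>A\<close>
  and the naturals; the sum is used because it is infinite also for finite \<open>A\<close>.\<close>

lemma ex_common_non_atom:
  assumes disj: "\<And>F G. F \<in> \<F> \<Longrightarrow> G \<in> \<F> \<Longrightarrow> F \<noteq> G \<Longrightarrow> inf F G = bot"
    and "uncountable \<F>" and "|A| <o |\<F>|"
  obtains F where "F \<in> \<F>" "\<And>f. f \<in> A \<Longrightarrow> \<not> (\<exists>e>0. atom_above e f F)"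
proof -
  define N where "N = (\<Union>f\<in>A. {F \<in> \<F>. \<exists>e>0. atom_above e f F})"
  have "|{F \<in> \<F>. \<exists>e>0. atom_above e f F}| \<le>o |UNIV :: nat set|" for f
    using countable_atoms[OF disj] unfolding countable_def card_of_ordLeq[symmetric] by auto
  then have "|{F \<in> \<F>. \<exists>e>0. atom_above e f F}| \<le>o |A <+> (UNIV :: nat set)|" for f
    using card_of_Plus2 ordLeq_transitive by blast
  then have "|N| \<le>o |A <+> (UNIV :: nat set)|"
    unfolding N_def by (intro card_of_UNION_ordLeq_infinite) (auto simp: card_of_Plus1)
  also have "|A <+> (UNIV :: nat set)| <o |\<F>|"
  proof (rule card_of_Plus_ordLess_infinite)
    show "infinite \<F>"
      using \<open>uncountable \<F>\<close> countable_finite by blast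
    have "\<not> |\<F>| \<le>o |UNIV :: nat set|"
      using \<open>uncountable \<F>\<close> unfolding countable_def card_of_ordLeq[symmetric] by auto
    then show "|UNIV :: nat set| <o |\<F>|"
      by (simp add: not_ordLeq_iff_ordLess card_of_Well_order)
  qed fact
  finally have "N \<noteq> \<F>"
    using ordLess_irreflexive by blast
  moreover have "N \<subseteq> \<F>"
    by (auto simp: N_def)
  ultimately obtain F where "F \<in> \<F>" "F \<notin> N"
    by blast
  then show ?thesis
    by (intro that[of F]) (auto simp: N_def)
qed

text \<open>The multiples of a point evaluation form an uncountable set of functionals, so the hypothesis on
  cardinalities also makes \<open>\<F>\<close> uncountable, which \<open>ex_common_non_atom\<close> requires.\<close>

theorem one_ASD2P_of_points:
  fixes \<F> :: "'a::topological_space filter set"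
  assumes pts: "\<And>F. F \<in> \<F> \<Longrightarrow> point_filter F"
    and disj: "\<And>F G. F \<in> \<F> \<Longrightarrow> G \<in> \<F> \<Longrightarrow> F \<noteq> G \<Longrightarrow> inf F G = bot"
    and card: "|UNIV :: (('a \<Rightarrow>\<^sub>C real) \<Rightarrow>\<^sub>L real) set| \<le>o |\<F>|"
  shows "one_ASD2P_below TYPE('a \<Rightarrow>\<^sub>C real) |UNIV :: (('a \<Rightarrow>\<^sub>C real) \<Rightarrow>\<^sub>L real) set|"
proof -
  let ?D = "UNIV :: (('a \<Rightarrow>\<^sub>C real) \<Rightarrow>\<^sub>L real) set"
  obtain F0 where "F0 \<in> \<F>"
    using card by (metis UNIV_not_empty all_not_in_conv card_of_empty3)
  then have "point_evaluation F0 \<noteq> 0"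
    using norm_point_evaluation[OF pts] by force
  then have "inj (\<lambda>c. c *\<^sub>R point_evaluation F0)"
    by (auto intro: injI)
  then have unc: "uncountable ?D"
    by (metis countable_image_inj_on countable_subset subset_UNIV uncountable_UNIV_real)
  then have inf: "infinite ?D"
    using countable_finite by blast
  have "uncountable \<F>"
    using unc card unfolding card_of_ordLeq[symmetric]
    by (metis countable_image_inj_on countable_subset)
  have "\<exists>B. \<exists>f :: ('a \<Rightarrow>\<^sub>C real) \<Rightarrow>\<^sub>L real. B \<subseteq> sphere 0 1 \<and> f \<in> sphere 0 1 \<and>
          norms B A \<and> (\<forall>x\<in>B. blinfun_apply f x = 1)"
    if A: "A \<subseteq> sphere 0 1" "|A| <o |?D|" for A
  proof -
    have "|A| <o |\<F>|"
      using A(2) card by (rule ordLess_ordLeq_trans)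
    then obtain F where F: "F \<in> \<F>" and na: "\<And>f. f \<in> A \<Longrightarrow> \<not> (\<exists>e>0. atom_above e f F)"
      using ex_common_non_atom[OF disj \<open>uncountable \<F>\<close>] by blast
    define B where "B = {x \<in> sphere 0 1. blinfun_apply (point_evaluation F) x = 1}"
    have "norms B A"
      unfolding norms_def
    proof (intro ballI)
      fix r :: real and f
      assume r: "r \<in> {0<..<1}" and "f \<in> A"
      then have f: "norm f = 1"
        using A(1) by auto
      obtain y where "norm y = 1" "blinfun_apply (point_evaluation F) y = 1" "r \<le> blinfun_apply f y"
        using norming_function_through_point[OF pts[OF F] na[OF \<open>f \<in> A\<close>], of r] r f by auto
      then show "\<exists>x\<in>B - {0}. r * norm f * norm x \<le> blinfun_apply f x"
        using f by (intro bexI[of _ y]) (auto simp: B_def)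
    qed
    then show ?thesis
      using norm_point_evaluation[OF pts[OF F]]
      by (intro exI[of _ B] exI[of _ "point_evaluation F"]) (auto simp: B_def)
  qed
  then show ?thesis
    using inf by (simp add: one_ASD2P_below_def cinfinite_def Field_card_of card_of_card_order_on)
qed

section \<open>Coding sequences of reals\<close>

lemma inj_real_nat_set: "\<exists>c :: real \<Rightarrow> nat set. inj c"
  using nat_sets_eqpoll_reals by (metis eqpoll_imp_lepoll eqpoll_sym lepoll_def)

text \<open>A sequence of reals, coded by a sequence of sets of naturals, is coded by a single set of
  pairs.\<close>

lemma inj_real_sequence_nat_set: "\<exists>h :: (nat \<Rightarrow> real) \<Rightarrow> nat set. inj h"
proof -
  obtain c :: "real \<Rightarrow> nat set" where c: "inj c"
    using inj_real_nat_set by blast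
  have "inj (\<lambda>x. prod_encode ` (SIGMA n:UNIV. c (x n)))"
  proof (rule injI)
    fix x y :: "nat \<Rightarrow> real"
    assume "prod_encode ` (SIGMA n:UNIV. c (x n)) = prod_encode ` (SIGMA n:UNIV. c (y n))"
    then have "(SIGMA n:UNIV. c (x n)) = (SIGMA n:UNIV. c (y n))"
      by (simp add: inj_image_eq_iff inj_prod_encode)
    then have "c (x n) = c (y n)" for n
      by (auto simp: set_eq_iff)
    then show "x = y"
      using c by (intro ext) (simp add: inj_eq)
  qed
  then show ?thesis by blast
qed

section \<open>Continuous functions on the interval\<close>

lemma point_filter_nhds: "point_filter (nhds (s :: 'a::metric_space))"
  unfolding point_filter_def
proof (intro conjI allI impI)
  show "nhds s \<noteq> bot"
    by simp
  show "\<exists>l. (apply_bcontfun x \<longlongrightarrow> l) (nhds s)" for x :: "'a \<Rightarrow>\<^sub>C real"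
    using continuous_on_apply_bcontfun[of UNIV x]
    by (auto simp: continuous_on_def tendsto_at_iff_tendsto_nhds)
  fix P assume "eventually P (nhds s)"
  then obtain d where d: "d > 0" "\<And>t. dist t s < d \<Longrightarrow> P t"
    unfolding eventually_nhds_metric by blast
  have cont: "continuous_on UNIV (\<lambda>t. max 0 (1 - dist t s / d))"
    using d by (intro continuous_intros) auto
  have "(\<lambda>t. max 0 (1 - dist t s / d)) \<in> bcontfun"
    by (rule bcontfun_normI[OF cont, of 1]) (use d in auto)
  then obtain g :: "'a \<Rightarrow>\<^sub>C real" where g: "\<And>t. g t = max 0 (1 - dist t s / d)"
    by (metis bcontfunE)
  have "(g \<longlongrightarrow> g s) (nhds s)"
    using continuous_on_apply_bcontfun[of UNIV g]
    by (auto simp: continuous_on_def tendsto_at_iff_tendsto_nhds)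
  then have "(g \<longlongrightarrow> 1) (nhds s)"
    by (simp add: g)
  moreover have "g t = 0" if "\<not> P t" for t
  proof -
    have "d \<le> dist t s"
      using d(2) that not_le by blast
    then show ?thesis
      using d(1) by (simp add: g)
  qed
  moreover have "0 \<le> g t \<and> g t \<le> 1" for t
    using d by (auto simp: g)
  ultimately show "\<exists>g :: 'a \<Rightarrow>\<^sub>C real.
      (\<forall>t. 0 \<le> g t \<and> g t \<le> 1) \<and> (\<forall>t. \<not> P t \<longrightarrow> g t = 0) \<and> (g \<longlongrightarrow> 1) (nhds s)"
    by blast
qed

lemma inf_nhds_eq_bot:
  fixes s t :: "'a::t2_space"
  assumes "s \<noteq> t"
  shows "inf (nhds s) (nhds t) = bot"
proof -
  obtain U V where "open U" "open V" "s \<in> U" "t \<in> V" "U \<inter> V = {}"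
    using hausdorff[OF assms] by blast
  then have "eventually (\<lambda>_. False) (inf (nhds s) (nhds t))"
    unfolding eventually_inf
    by (intro exI[of _ "\<lambda>x. x \<in> U"] exI[of _ "\<lambda>x. x \<in> V"]) (auto intro: eventually_nhds_in_open)
  then show ?thesis
    by (simp add: trivial_limit_def)
qed

definition monomial :: "nat \<Rightarrow> C01" where
  "monomial n = Bcontfun (\<lambda>t. Rep_unit_interval t ^ n)"

lemma apply_monomial: "apply_bcontfun (monomial n) t = Rep_unit_interval t ^ n"
proof -
  have "(\<lambda>t. Rep_unit_interval t ^ n) \<in> bcontfun"
  proof (rule bcontfun_normI[where b = 1])
    show "continuous_on UNIV (\<lambda>t. Rep_unit_interval t ^ n)"
      by (intro continuous_intros continuous_on_Rep_unit_interval)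
    show "norm (Rep_unit_interval t ^ n) \<le> 1" for t
      using Rep_unit_interval[of t] by (simp add: power_le_one norm_power)
  qed
  then show ?thesis
    by (simp add: monomial_def Bcontfun_inverse)
qed

lemma C01_approx_by_monomials:
  fixes x :: C01
  assumes "e > 0"
  obtains a and n :: nat where "norm (x - (\<Sum>i\<le>n. a i *\<^sub>R monomial i)) \<le> e"
proof -
  have "continuous_on {0..1} (\<lambda>t. x (Abs_unit_interval t))"
    unfolding continuous_on_unit_interval_iff_C01 by blast
  then obtain p where p: "real_polynomial_function p"
    and close: "\<And>t. t \<in> {0..1} \<Longrightarrow> \<bar>x (Abs_unit_interval t) - p t\<bar> < e"
    using Stone_Weierstrass_real_polynomial_function[OF compact_Icc _ assms] by blast
  obtain a and n :: nat where a: "p = (\<lambda>t. \<Sum>i\<le>n. a i * t ^ i)"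
    using p real_polynomial_function_iff_sum by blast
  have "norm (x - (\<Sum>i\<le>n. a i *\<^sub>R monomial i)) \<le> e"
  proof (rule norm_bound)
    fix t
    show "norm (apply_bcontfun (x - (\<Sum>i\<le>n. a i *\<^sub>R monomial i)) t) \<le> e"
      using close[OF Rep_unit_interval[of t]]
      by (simp add: apply_bcontfun_sum apply_monomial a Rep_unit_interval_inverse)
  qed
  then show ?thesis
    by (rule that)
qed

lemma functional_determined_by_monomials:
  fixes f g :: "C01 \<Rightarrow>\<^sub>L real"
  assumes eq: "\<And>n. blinfun_apply f (monomial n) = blinfun_apply g (monomial n)"
  shows "f = g"
proof (rule blinfun_eqI)
  fix x :: C01
  have "\<bar>blinfun_apply (f - g) x\<bar> \<le> 0 + e" if "e > 0" for e
  proof -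
    define d where "d = e / (norm (f - g) + 1)"
    have "d > 0"
      using that by (simp add: d_def add_nonneg_pos)
    then obtain a and n :: nat where a: "norm (x - (\<Sum>i\<le>n. a i *\<^sub>R monomial i)) \<le> d"
      by (rule C01_approx_by_monomials)
    have "blinfun_apply (f - g) x = blinfun_apply (f - g) (x - (\<Sum>i\<le>n. a i *\<^sub>R monomial i))"
      by (simp add: blinfun.diff_left blinfun.diff_right blinfun.sum_right blinfun.scaleR_right eq)
    also have "\<bar>\<dots>\<bar> \<le> norm (f - g) * norm (x - (\<Sum>i\<le>n. a i *\<^sub>R monomial i))"
      using norm_blinfun[of "f - g" "x - (\<Sum>i\<le>n. a i *\<^sub>R monomial i)"] by (simp only: real_norm_def)
    also have "\<dots> \<le> norm (f - g) * d"
      by (rule mult_left_mono[OF a norm_ge_zero])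
    also have "\<dots> \<le> (norm (f - g) + 1) * d"
      using \<open>d > 0\<close> by (simp add: mult_right_mono)
    also have "\<dots> = e"
      by (simp add: d_def add_nonneg_eq_0_iff)
    finally show ?thesis by simp
  qed
  then have "\<bar>blinfun_apply (f - g) x\<bar> \<le> 0"
    by (rule field_le_epsilon)
  then show "blinfun_apply f x = blinfun_apply g x"
    by (simp add: blinfun.diff_left)
qed

lemma inj_nat_set_unit_interval: "\<exists>d :: nat set \<Rightarrow> unit_interval. inj d"
proof -
  obtain h :: "nat set \<Rightarrow> real" where h: "inj h" "range h \<subseteq> {0..<1}"
    using nat_sets_lepoll_reals01 unfolding lepoll_def by blast
  have "inj (\<lambda>S. Abs_unit_interval (h S))"
  proof (rule injI)
    fix S T assume "Abs_unit_interval (h S) = Abs_unit_interval (h T)"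
    moreover have "h S \<in> {0..1}" "h T \<in> {0..1}"
      using h(2) by (auto simp: less_imp_le subset_iff)
    ultimately show "S = T"
      using h(1) by (metis Abs_unit_interval_inject injD)
  qed
  then show ?thesis by blast
qed

lemma card_dual_C01:
  "|UNIV :: (C01 \<Rightarrow>\<^sub>L real) set| \<le>o |range (nhds :: unit_interval \<Rightarrow> unit_interval filter)|"
proof -
  obtain h :: "(nat \<Rightarrow> real) \<Rightarrow> nat set" where h: "inj h"
    using inj_real_sequence_nat_set by blast
  obtain d :: "nat set \<Rightarrow> unit_interval" where d: "inj d"
    using inj_nat_set_unit_interval by blast
  have "inj (\<lambda>f :: C01 \<Rightarrow>\<^sub>L real. h (\<lambda>n. blinfun_apply f (monomial n)))"
  proof (rule injI)
    fix f g :: "C01 \<Rightarrow>\<^sub>L real"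
    assume "h (\<lambda>n. blinfun_apply f (monomial n)) = h (\<lambda>n. blinfun_apply g (monomial n))"
    then have "(\<lambda>n. blinfun_apply f (monomial n)) = (\<lambda>n. blinfun_apply g (monomial n))"
      using h by (simp only: inj_eq)
    then show "f = g"
      by (intro functional_determined_by_monomials) (rule fun_cong)
  qed
  moreover have "inj (nhds :: unit_interval \<Rightarrow> unit_interval filter)"
    by (rule injI) (metis inf.idem inf_nhds_eq_bot nhds_neq_bot)
  ultimately have "inj (\<lambda>f :: C01 \<Rightarrow>\<^sub>L real. nhds (d (h (\<lambda>n. blinfun_apply f (monomial n)))))"
    using d by (auto simp: inj_def)
  then show ?thesis
    unfolding card_of_ordLeq[symmetric] by blast
qed

lemma one_ASD2P_C01: "one_ASD2P_below TYPE(C01) |UNIV :: (C01 \<Rightarrow>\<^sub>L real) set|"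
proof (rule one_ASD2P_of_points[OF _ _ card_dual_C01])
  fix F G :: "unit_interval filter"
  assume "F \<in> range nhds"
  then obtain s where s: "F = nhds s" by blast
  then show "point_filter F"
    by (simp add: point_filter_nhds)
  assume "G \<in> range nhds" "F \<noteq> G"
  then obtain t where "G = nhds t" "s \<noteq> t"
    using s by blast
  then show "inf F G = bot"
    using s by (simp add: inf_nhds_eq_bot)
qed

section \<open>Ultrafilters on the natural numbers\<close>

definition ultrafilter :: "'a filter \<Rightarrow> bool" where
  "ultrafilter U \<longleftrightarrow> U \<noteq> bot \<and> (\<forall>P. eventually P U \<or> eventually (\<lambda>t. \<not> P t) U)"

text \<open>By Zorn's lemma there is a minimal proper filter below \<open>F\<close>. For each \<open>P\<close>, restricting this filter
  to \<open>P\<close> either gives the same filter or an improper one.\<close>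

lemma ex_ultrafilter:
  fixes F :: "'a filter"
  assumes "F \<noteq> bot"
  obtains U where "U \<le> F" "ultrafilter U"
proof -
  define A where "A = {G. G \<noteq> bot \<and> G \<le> F}"
  have "\<exists>U\<in>A. \<forall>G\<in>A. G \<le> U \<longrightarrow> G = U"
  proof (rule predicate_Zorn)
    show "partial_order_on A (relation_of (\<lambda>G H. H \<le> G) A)"
      by (rule partial_order_on_relation_ofI) (blast intro: order_trans antisym)+
    fix C assume C: "C \<in> Chains (relation_of (\<lambda>G H. H \<le> G) A)"
    then have sub: "C \<subseteq> A" and total: "\<And>G H. G \<in> C \<Longrightarrow> H \<in> C \<Longrightarrow> G \<le> H \<or> H \<le> G"
      unfolding Chains_def relation_of_def by blast+
    show "\<exists>u\<in>A. \<forall>G\<in>C. u \<le> G"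
    proof (cases "C = {}")
      case True
      then show ?thesis
        using assms by (auto simp: A_def)
    next
      case False
      have "eventually P (Inf C) \<longleftrightarrow> (\<exists>G\<in>C. eventually P G)" for P
      proof (rule eventually_Inf_base[OF False])
        show "\<exists>K\<in>C. K \<le> inf G H" if "G \<in> C" "H \<in> C" for G H
          using total[OF that] that by (auto simp: le_inf_iff)
      qed
      then have "Inf C \<noteq> bot"
        using sub unfolding trivial_limit_def A_def by blast
      moreover have "Inf C \<le> F"
        using False sub by (auto simp: A_def intro: Inf_lower2)
      ultimately show ?thesis
        by (intro bexI[of _ "Inf C"]) (auto simp: A_def Inf_lower)
    qed
  qed
  then obtain U where U: "U \<noteq> bot" "U \<le> F"
    and min: "\<And>G. G \<noteq> bot \<Longrightarrow> G \<le> F \<Longrightarrow> G \<le> U \<Longrightarrow> G = U"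
    by (auto simp: A_def)
  have "eventually P U \<or> eventually (\<lambda>t. \<not> P t) U" for P
  proof (cases "inf U (principal {t. P t}) = bot")
    case True
    then have "eventually (\<lambda>_. False) (inf U (principal {t. P t}))"
      by simp
    then show ?thesis
      by (simp add: eventually_inf_principal)
  next
    case False
    then have "inf U (principal {t. P t}) = U"
      using U(2) by (intro min) (auto intro: le_infI1)
    moreover have "eventually P (inf U (principal {t. P t}))"
      by (simp add: eventually_inf_principal)
    ultimately show ?thesis
      by simp
  qed
  with U show ?thesis
    by (intro that[of U]) (auto simp: ultrafilter_def)
qed

lemma ultrafilter_le:
  assumes "ultrafilter U" "inf U G \<noteq> bot"
  shows "U \<le> G"
proof (rule filter_leI)
  fix P assume "eventually P G"
  show "eventually P U"
  proof (rule ccontr)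
    assume "\<not> eventually P U"
    then have "eventually (\<lambda>t. \<not> P t) U"
      using assms(1) by (auto simp: ultrafilter_def)
    with \<open>eventually P G\<close> have "eventually (\<lambda>_. False) (inf U G)"
      unfolding eventually_inf by blast
    with assms(2) show False
      by (simp add: trivial_limit_def)
  qed
qed

lemma inf_ultrafilters_eq_bot:
  assumes "ultrafilter U" "ultrafilter V" "U \<noteq> V"
  shows "inf U V = bot"
  using assms ultrafilter_le[of U V] ultrafilter_le[of V U] by (metis antisym inf.commute)

text \<open>By compactness the image ultrafilter has a cluster point, and an ultrafilter converges to each
  of its cluster points.\<close>

lemma ultrafilter_tendsto:
  fixes x :: "'a \<Rightarrow> 'b::heine_borel"
  assumes U: "ultrafilter U" and "bounded (range x)"
  shows "\<exists>l. (x \<longlongrightarrow> l) U"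
proof -
  have "compact (closure (range x))"
    using assms(2) by (simp add: compact_closure)
  moreover have "filtermap x U \<noteq> bot"
    using U by (simp add: ultrafilter_def filtermap_bot_iff)
  moreover have "eventually (\<lambda>y. y \<in> closure (range x)) (filtermap x U)"
    unfolding eventually_filtermap using closure_subset[of "range x"] by (intro always_eventually) auto
  ultimately obtain l where l: "inf (nhds l) (filtermap x U) \<noteq> bot"
    unfolding compact_filter by blast
  have "ultrafilter (filtermap x U)"
    using U by (simp add: ultrafilter_def filtermap_bot_iff eventually_filtermap)
  then show ?thesis
    using l ultrafilter_le[of "filtermap x U" "nhds l"] by (auto simp: filterlim_def inf.commute)
qed

lemma point_filter_ultrafilter:
  fixes U :: "'a::discrete_topology filter"
  assumes U: "ultrafilter U"
  shows "point_filter U"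
  unfolding point_filter_def
proof (intro conjI allI impI)
  show "U \<noteq> bot"
    using U by (simp add: ultrafilter_def)
  show "\<exists>l. (apply_bcontfun x \<longlongrightarrow> l) U" for x :: "'a \<Rightarrow>\<^sub>C real"
    using U by (rule ultrafilter_tendsto) simp
  fix P assume P: "eventually P U"
  have "(\<lambda>t. if P t then 1 else 0 :: real) \<in> bcontfun"
    by (rule bcontfun_normI[where b = 1]) auto
  then obtain g :: "'a \<Rightarrow>\<^sub>C real" where "(\<lambda>t. if P t then 1 else 0) = apply_bcontfun g"
    by (rule bcontfunE)
  then have g: "g t = (if P t then 1 else 0)" for t
    by (simp add: fun_eq_iff)
  have "eventually (\<lambda>t. g t = 1) U"
    using P by eventually_elim (simp add: g)
  then have "(g \<longlongrightarrow> 1) U"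
    by (rule tendsto_eventually)
  then show "\<exists>g :: 'a \<Rightarrow>\<^sub>C real.
      (\<forall>t. 0 \<le> g t \<and> g t \<le> 1) \<and> (\<forall>t. \<not> P t \<longrightarrow> g t = 0) \<and> (g \<longlongrightarrow> 1) U"
    by (intro exI[of _ g]) (auto simp: g)
qed

text \<open>The Fichtenholz-Kantorovich-Hausdorff independent family: a natural number codes a finite
  set \<open>E\<close> and a finite set of finite sets, and it belongs to the member with index \<open>A\<close> if the trace
  \<open>A \<inter> E\<close> is in the latter. Finitely many sets are distinguished by their traces on some finite
  \<open>E\<close>, and the listed traces can be chosen freely. Lists are used instead of finite sets because
  they form a countable type.\<close>

definition independent_family :: "nat set \<Rightarrow> nat set" where
  "independent_family A =
     {n. case from_nat n :: nat list \<times> nat list list of (E, Ts) \<Rightarrow> A \<inter> set E \<in> set ` set Ts}"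

lemma finite_trace_distinguishes:
  assumes "finite (\<A> :: 'a set set)"
  obtains E where "finite E" "\<And>A B. A \<in> \<A> \<Longrightarrow> B \<in> \<A> \<Longrightarrow> A \<inter> E = B \<inter> E \<Longrightarrow> A = B"
proof -
  have "\<exists>t. A \<noteq> B \<longrightarrow> (t \<in> A \<longleftrightarrow> t \<notin> B)" for A B :: "'a set"
    by blast
  then obtain t where t: "\<And>A B :: 'a set. A \<noteq> B \<Longrightarrow> t A B \<in> A \<longleftrightarrow> t A B \<notin> B"
    by metis
  have "A = B" if "A \<in> \<A>" "B \<in> \<A>" "A \<inter> (\<lambda>(A, B). t A B) ` (\<A> \<times> \<A>) = B \<inter> (\<lambda>(A, B). t A B) ` (\<A> \<times> \<A>)" for A B
  proof (rule ccontr)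
    assume "A \<noteq> B"
    moreover have "t A B \<in> (\<lambda>(A, B). t A B) ` (\<A> \<times> \<A>)"
      using that by force
    ultimately show False
      using t[of A B] that(3) by blast
  qed
  then show ?thesis
    using that[of "(\<lambda>(A, B). t A B) ` (\<A> \<times> \<A>)"] assms by blast
qed

lemma independent_family:
  assumes "finite \<A>"
  shows "\<exists>n. \<forall>A\<in>\<A>. n \<in> independent_family A \<longleftrightarrow> A \<in> \<S>"
proof -
  obtain E where E: "finite E" "\<And>A B. A \<in> \<A> \<Longrightarrow> B \<in> \<A> \<Longrightarrow> A \<inter> E = B \<inter> E \<Longrightarrow> A = B"
    using finite_trace_distinguishes[OF assms] by blast
  obtain es where es: "set es = E"
    using E(1) finite_list by blast
  obtain As where As: "set As = \<A> \<inter> \<S>"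
    using finite_list[of "\<A> \<inter> \<S>"] assms by auto
  define n where "n = to_nat (es, map (\<lambda>A. sorted_list_of_set (A \<inter> E)) As)"
  have "n \<in> independent_family A \<longleftrightarrow> A \<inter> E \<in> (\<lambda>A. A \<inter> E) ` (\<A> \<inter> \<S>)" for A
    using E(1) by (simp add: n_def independent_family_def es As image_image)
  then have "n \<in> independent_family A \<longleftrightarrow> A \<in> \<S>" if "A \<in> \<A>" for A
    using E(2) that by auto
  then show ?thesis by blast
qed

text \<open>This is half of Pospisil's theorem: each choice of members and complements of members of the
  independent family extends to an ultrafilter.\<close>

lemma many_ultrafilters:
  obtains U :: "nat set set \<Rightarrow> nat filter" where "inj U" "\<And>\<S>. ultrafilter (U \<S>)"
proof -
  have "\<exists>U. ultrafilter U \<and> (\<forall>A. eventually (\<lambda>n. n \<in> independent_family A \<longleftrightarrow> A \<in> \<S>) U)" for \<S>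
  proof -
    define F where "F = (INF A. principal {n. n \<in> independent_family A \<longleftrightarrow> A \<in> \<S>})"
    have "F \<noteq> bot"
      unfolding F_def
    proof (rule INF_filter_not_bot)
      fix \<A> :: "nat set set" assume "finite \<A>"
      then show "(INF A\<in>\<A>. principal {n. n \<in> independent_family A \<longleftrightarrow> A \<in> \<S>}) \<noteq> bot"
        using independent_family[of \<A> \<S>]
        by (simp add: INF_principal_finite principal_eq_bot_iff set_eq_iff)
    qed
    then obtain U where "U \<le> F" "ultrafilter U"
      by (rule ex_ultrafilter)
    moreover have "eventually (\<lambda>n. n \<in> independent_family A \<longleftrightarrow> A \<in> \<S>) F" for A
      unfolding F_def by (rule eventually_INF1[of A]) (auto simp: eventually_principal)
    ultimately show ?thesis
      by (meson filter_leD)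
  qed
  then obtain U where U: "\<And>\<S>. ultrafilter (U \<S>)"
    and ev: "\<And>\<S> A. eventually (\<lambda>n. n \<in> independent_family A \<longleftrightarrow> A \<in> \<S>) (U \<S>)"
    by metis
  have "inj U"
  proof (rule injI)
    fix \<S> \<T> assume eq: "U \<S> = U \<T>"
    have "A \<in> \<S> \<longleftrightarrow> A \<in> \<T>" for A
    proof -
      have "eventually (\<lambda>n. A \<in> \<S> \<longleftrightarrow> A \<in> \<T>) (U \<S>)"
        using ev[of A \<S>] ev[of A \<T>] unfolding eq by eventually_elim blast
      then show ?thesis
        using U[of \<S>] by (simp add: ultrafilter_def)
    qed
    then show "\<S> = \<T>" by blast
  qed
  with U show ?thesis
    by (rule that[rotated])
qed

section \<open>Bounded sequences\<close>

text \<open>A functional on the bounded sequences is coded by a set of pairs of a sequence and a natural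
  number, and each of these pairs by a set of naturals, so that \<open>many_ultrafilters\<close> applies.\<close>

lemma card_dual_l_infty:
  "|UNIV :: (l_infty \<Rightarrow>\<^sub>L real) set| \<le>o |{U :: nat filter. ultrafilter U}|"
proof -
  obtain c :: "real \<Rightarrow> nat set" where c: "inj c"
    using inj_real_nat_set by blast
  obtain h :: "(nat \<Rightarrow> real) \<Rightarrow> nat set" where h: "inj h"
    using inj_real_sequence_nat_set by blast
  obtain U :: "nat set set \<Rightarrow> nat filter" where U: "inj U" "\<And>\<S>. ultrafilter (U \<S>)"
    using many_ultrafilters by blast
  define pair where "pair = (\<lambda>(x :: l_infty, m :: nat). sum_encode ` (h (apply_bcontfun x) <+> {m}))"
  have "inj pair"
  proof (rule injI, clarify)
    fix x y m n assume "pair (x, m) = pair (y, n)"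
    then have "h (apply_bcontfun x) <+> {m} = h (apply_bcontfun y) <+> {n}"
      by (simp add: pair_def inj_image_eq_iff inj_sum_encode)
    then have "h (apply_bcontfun x) = h (apply_bcontfun y)" "m = n"
      by (auto simp: set_eq_iff Plus_def)
    then show "x = y \<and> m = n"
      using h by (simp add: inj_eq apply_bcontfun_inject)
  qed
  define code where "code f = pair ` (SIGMA x:UNIV. c (blinfun_apply f x))"
    for f :: "l_infty \<Rightarrow>\<^sub>L real"
  have "inj code"
  proof (rule injI)
    fix f g assume "code f = code g"
    then have "(SIGMA x:UNIV. c (blinfun_apply f x)) = (SIGMA x:UNIV. c (blinfun_apply g x))"
      using \<open>inj pair\<close> by (simp add: code_def inj_image_eq_iff)
    then have "c (blinfun_apply f x) = c (blinfun_apply g x)" for x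
      by (auto simp: set_eq_iff)
    then show "f = g"
      using c by (intro blinfun_eqI) (simp add: inj_eq)
  qed
  then have "inj (\<lambda>f. U (code f))"
    using U(1) by (auto simp: inj_def)
  moreover have "range (\<lambda>f. U (code f)) \<subseteq> {U. ultrafilter U}"
    using U(2) by blast
  ultimately show ?thesis
    unfolding card_of_ordLeq[symmetric] by blast
qed

lemma one_ASD2P_l_infty: "one_ASD2P_below TYPE(l_infty) |UNIV :: (l_infty \<Rightarrow>\<^sub>L real) set|"
  by (rule one_ASD2P_of_points[OF _ _ card_dual_l_infty])
    (simp_all add: point_filter_ultrafilter inf_ultrafilters_eq_bot)

theorem corollary6p4:
  shows "one_ASD2P_below TYPE(C01) |UNIV :: (C01 \<Rightarrow>\<^sub>L real) set| \<and>
         one_ASD2P_below TYPE(l_infty) |UNIV :: (l_infty \<Rightarrow>\<^sub>L real) set|"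
  using one_ASD2P_C01 one_ASD2P_l_infty by blast

end
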